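(* Let $R$ be an integral domain with a discrete multiplicative norm $\|\cdot\|\colon R\to\mathbb{N}$. If a quadratic form $q$ over $R$ is Euclidean with respect to $\|\cdot\|$, then $q$ is an ADC form.
   Context: Here $\mathbb{N}$ denotes the non-negative integers (including $0$). A discrete multiplicative norm on a commutative ring $R$ with unity $1\neq 0$ is a mapping $\|\cdot\|\colon R\to\mathbb{N}$ such that (N0) for every $x\in R$, $\|x\|=0$ if and only if $x=0$; and (N1) for all $x,y\in R$, $\|xy\|=\|x\|\,\|y\|$. Let $K$ be the field of fractions of the integral domain $R$. The norm extends in a unique way to a mapping $\|\cdot\|\colon K\to\mathbb{Q}_{\geq 0}$ satisfying (N1) on $K$ (and then also (N0)), namely $\|a/b\|=\|a\|/\|b\|$ for $a,b\in R$, $b\neq 0$; this extended mapping is again written $\|\cdot\|$. A form over $R$ is a homogeneous polynomial in $R[X_1,\dots,X_d]$ with $d>0$; a quadratic form is a form of degree $2$. A form $g$ over $R$ in $d$ variables, of any degree, is Euclidean with respect to the norm $\|\cdot\|$ if for every $x\in K^d\setminus R^d$ there exists $y\in R^d$ such that $0<\|g(x-y)\|<1$. A form $g$ over $R$ in $d$ variables is an ADC form (Aubry-Davenport-Cassels form) if for every $x\in K^d$ with $g(x)\in R$ there exists $y\in R^d$ such that $g(y)=g(x)$. No restriction is imposed on the characteristic of $R$. *)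

theory Defs
  imports
    "HOL-Analysis.Finite_Cartesian_Product"
    "HOL-Library.Poly_Mapping"
    "HOL-Computational_Algebra.Polynomial_Factorial"
begin

definition discrete_mult_norm :: "('a::comm_ring_1 \<Rightarrow> nat) \<Rightarrow> bool" where
  "discrete_mult_norm N \<longleftrightarrow>
     (\<forall>x. N x = 0 \<longleftrightarrow> x = 0) \<and> (\<forall>x y. N (x * y) = N x * N y)"

definition fract_norm :: "('a::idom \<Rightarrow> nat) \<Rightarrow> 'a fract \<Rightarrow> rat" where
  "fract_norm N x =
     (THE r. \<exists>a b. b \<noteq> 0 \<and> x = Fraction_Field.Fract a b \<and> r = of_nat (N a) / of_nat (N b))"

lemma fract_norm_Fract:
  fixes N :: "'a::idom \<Rightarrow> nat"
  assumes N: "discrete_mult_norm N" and b: "b \<noteq> 0"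
  shows "fract_norm N (Fraction_Field.Fract a b) = of_nat (N a) / of_nat (N b)"
  unfolding fract_norm_def
proof (rule the_equality)
  show "\<exists>a' b'. b' \<noteq> 0 \<and> Fraction_Field.Fract a b = Fraction_Field.Fract a' b' \<and>
          (of_nat (N a) / of_nat (N b) :: rat) = of_nat (N a') / of_nat (N b')"
    using b by blast
next
  fix r :: rat
  assume "\<exists>a' b'. b' \<noteq> 0 \<and> Fraction_Field.Fract a b = Fraction_Field.Fract a' b' \<and>
            r = of_nat (N a') / of_nat (N b')"
  then obtain a' b' where b': "b' \<noteq> 0"
    and eq: "Fraction_Field.Fract a b = Fraction_Field.Fract a' b'"
    and r: "r = of_nat (N a') / of_nat (N b')"
    by blast
  have "N (a * b') = N (a' * b)"
    using eq b b' by (simp add: eq_fract)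
  then have "N a * N b' = N a' * N b"
    using N by (simp add: discrete_mult_norm_def)
  then have "(of_nat (N a) * of_nat (N b') :: rat) = of_nat (N a') * of_nat (N b)"
    by (metis of_nat_mult)
  moreover have "N b \<noteq> 0" "N b' \<noteq> 0"
    using N b b' by (auto simp: discrete_mult_norm_def)
  ultimately show "r = of_nat (N a) / of_nat (N b)"
    by (simp add: r frac_eq_eq)
qed

lemma fract_norm_unique:
  fixes N :: "'a::idom \<Rightarrow> nat" and M :: "'a fract \<Rightarrow> rat"
  assumes N: "discrete_mult_norm N"
    and ext: "\<And>a. M (to_fract a) = of_nat (N a)"
    and mult: "\<And>x y. M (x * y) = M x * M y"
  shows "M = fract_norm N"
proof
  fix x :: "'a fract"
  obtain a b where x: "x = Fraction_Field.Fract a b" and b: "b \<noteq> 0"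
    by (cases x) auto
  have "x * to_fract b = to_fract a"
    using b by (simp add: x to_fract_def eq_fract)
  then have "M x * of_nat (N b) = of_nat (N a)"
    by (metis ext mult)
  moreover have "N b \<noteq> 0"
    using N b by (simp add: discrete_mult_norm_def)
  ultimately show "M x = fract_norm N x"
    by (simp add: x fract_norm_Fract[OF N b] field_simps)
qed

text \<open>
  The finite type \<open>'n\<close> indexes the variables, so the number of variables is
  \<open>CARD('n) > 0\<close>. The outer finitely supported map sends each exponent vector to its
  coefficient.
\<close>

type_synonym ('n, 'a) mpolynomial = "('n \<Rightarrow>\<^sub>0 nat) \<Rightarrow>\<^sub>0 'a"

text \<open>The zero polynomial is a form of every degree.\<close>

definition form_of_degree :: "nat \<Rightarrow> ('n::finite, 'a::zero) mpolynomial \<Rightarrow> bool" where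
  "form_of_degree k g \<longleftrightarrow> (\<forall>m \<in> Poly_Mapping.keys g. (\<Sum>i\<in>UNIV. Poly_Mapping.lookup m i) = k)"

definition is_form :: "('n::finite, 'a::zero) mpolynomial \<Rightarrow> bool" where
  "is_form g \<longleftrightarrow> (\<exists>k. form_of_degree k g)"

definition quadratic_form :: "('n::finite, 'a::zero) mpolynomial \<Rightarrow> bool" where
  "quadratic_form g \<longleftrightarrow> form_of_degree 2 g"

definition eval_fract :: "('n::finite, 'a::idom) mpolynomial \<Rightarrow> 'a fract ^ 'n \<Rightarrow> 'a fract" where
  "eval_fract g x =
     (\<Sum>m\<in>Poly_Mapping.keys g.
        to_fract (Poly_Mapping.lookup g m) * (\<Prod>i\<in>UNIV. (x $ i) ^ Poly_Mapping.lookup m i))"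

text \<open>The copy of \<open>R\<^sup>d\<close> inside \<open>K\<^sup>d\<close>.\<close>

definition integral_vectors :: "('a::idom fract ^ 'n) set" where
  "integral_vectors = {x. \<forall>i. x $ i \<in> range to_fract}"

definition euclidean_form :: "('a::idom \<Rightarrow> nat) \<Rightarrow> ('n::finite, 'a) mpolynomial \<Rightarrow> bool" where
  "euclidean_form N g \<longleftrightarrow> is_form g \<and>
     (\<forall>x. x \<notin> integral_vectors \<longrightarrow>
        (\<exists>y\<in>integral_vectors.
           0 < fract_norm N (eval_fract g (x - y)) \<and> fract_norm N (eval_fract g (x - y)) < 1))"

definition ADC_form :: "('n::finite, 'a::idom) mpolynomial \<Rightarrow> bool" where
  "ADC_form g \<longleftrightarrow> is_form g \<and>
     (\<forall>x. eval_fract g x \<in> range to_fract \<longrightarrow>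
        (\<exists>y\<in>integral_vectors. eval_fract g y = eval_fract g x))"

end

theory Submission
  imports Defs
begin

text \<open>
  The proof is the descent of Aubry, Davenport and Cassels. Suppose \<open>q\<close> takes the value
  \<open>d \<in> R\<close> at a point \<open>x\<close> with denominator \<open>t\<close>, that is, \<open>t x\<close> is integral. If \<open>x\<close> itself is
  not integral, the Euclidean property gives an integral \<open>y\<close> with \<open>0 < \<parallel>q(x - y)\<parallel> < 1\<close>. The line
  through \<open>y\<close> and \<open>x\<close> meets the quadric \<open>q = d\<close> in \<open>x\<close> and, counting multiplicity, in a second point
  \<open>z = y + \<lambda> (x - y)\<close>, where \<open>\<lambda> = (q(y) - d) / q(x - y)\<close>.
  With the polar form \<open>B(x,y) = q(x + y) - q(x) - q(y)\<close>, which is integral on integral vectors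
  and homogeneous in each argument, one has \<open>q(x - y) = d + q(y) - B(x,y)\<close>; hence
  \<open>t' = t q(x - y)\<close> lies in \<open>R\<close>. This \<open>t'\<close> is a denominator of \<open>z\<close>, it is nonzero, and
  \<open>\<parallel>t'\<parallel> = \<parallel>t\<parallel> \<parallel>q(x - y)\<parallel> < \<parallel>t\<parallel>\<close> (\<open>chord_descent\<close>). As the norm of a denominator is a natural
  number, the descent ends at an integral point of the quadric.

  Working with \<open>B\<close> rather than with half of it avoids any division by \<open>2\<close>, so the argument
  is independent of the characteristic.
\<close>

section \<open>Integral elements and vectors\<close>

lemma range_to_fract_add:
  "a \<in> range to_fract \<Longrightarrow> b \<in> range to_fract \<Longrightarrow> a + b \<in> range to_fract"
  by (auto simp flip: to_fract_add)

lemma range_to_fract_diff: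
  "a \<in> range to_fract \<Longrightarrow> b \<in> range to_fract \<Longrightarrow> a - b \<in> range to_fract"
  by (auto simp flip: to_fract_diff)

lemma range_to_fract_mult:
  "a \<in> range to_fract \<Longrightarrow> b \<in> range to_fract \<Longrightarrow> a * b \<in> range to_fract"
  by (auto simp flip: to_fract_mult)

lemma range_to_fract_sum:
  assumes "\<And>i. i \<in> A \<Longrightarrow> f i \<in> range to_fract"
  shows "sum f A \<in> range to_fract"
  using assms
proof (induction A rule: infinite_finite_induct)
  case (insert i A)
  then show ?case by (simp add: range_to_fract_add)
qed (auto intro: range_eqI[of _ _ 0])

lemmas range_to_fract_intros =
  range_to_fract_add range_to_fract_diff range_to_fract_mult range_to_fract_sum

lemma integral_vectors_add:
  "x \<in> integral_vectors \<Longrightarrow> y \<in> integral_vectors \<Longrightarrow> x + y \<in> integral_vectors"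
  by (simp add: integral_vectors_def range_to_fract_add)

lemma common_denominator:
  fixes x :: "'a::idom fract ^ 'n::finite"
  obtains t where "t \<noteq> 0" "to_fract t *s x \<in> integral_vectors"
proof -
  have "\<exists>b. b \<noteq> 0 \<and> to_fract b * x $ i \<in> range to_fract" for i
  proof (cases "x $ i")
    case (Fract a b)
    then have "to_fract b * x $ i = to_fract a"
      by (simp add: to_fract_def eq_fract)
    with Fract show ?thesis by auto
  qed
  then obtain b where b: "\<And>i. b i \<noteq> 0" "\<And>i. to_fract (b i) * x $ i \<in> range to_fract"
    by metis
  define t where "t = prod b UNIV"
  have "to_fract t * x $ i \<in> range to_fract" for i
  proof -
    have "t = prod b (UNIV - {i}) * b i"
      unfolding t_def by (subst prod.remove[of UNIV i]) (simp_all add: mult.commute)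
    then have "to_fract t * x $ i = to_fract (prod b (UNIV - {i})) * (to_fract (b i) * x $ i)"
      by (simp only: to_fract_mult mult.assoc)
    also have "\<dots> \<in> range to_fract"
      by (rule range_to_fract_mult[OF rangeI b(2)])
    finally show ?thesis .
  qed
  moreover have "t \<noteq> 0"
    using b(1) by (simp add: t_def)
  ultimately show ?thesis
    by (intro that[of t]) (simp_all add: integral_vectors_def)
qed

section \<open>Quadratic forms as sums of products of two coordinates\<close>

lemma monomial_split_variable:
  fixes e :: "'n::finite \<Rightarrow> nat"
  assumes "sum e UNIV = Suc k"
  obtains i e' where "sum e' UNIV = k"
    and "\<And>x :: 'n \<Rightarrow> 'b::comm_monoid_mult. (\<Prod>j\<in>UNIV. x j ^ e j) = x i * (\<Prod>j\<in>UNIV. x j ^ e' j)"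
proof -
  have "\<exists>i. e i \<noteq> 0"
  proof (rule ccontr)
    assume "\<not> (\<exists>i. e i \<noteq> 0)"
    with assms show False by simp
  qed
  then obtain i l where l: "e i = Suc l"
    using not0_implies_Suc by blast
  define e' where "e' = e(i := l)"
  have rest: "sum e' (UNIV - {i}) = sum e (UNIV - {i})"
    "(\<Prod>j\<in>UNIV - {i}. x j ^ e' j) = (\<Prod>j\<in>UNIV - {i}. x j ^ e j)" for x :: "'n \<Rightarrow> 'b"
    by (auto intro!: sum.cong prod.cong simp: e'_def)
  show ?thesis
  proof (rule that[of e' i])
    show "sum e' UNIV = k"
      using assms rest l by (simp add: sum.remove[of UNIV i] e'_def)
    show "(\<Prod>j\<in>UNIV. x j ^ e j) = x i * (\<Prod>j\<in>UNIV. x j ^ e' j)" for x :: "'n \<Rightarrow> 'b"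
      using rest(2)[of x] l by (simp add: prod.remove[of UNIV i] e'_def mult.assoc)
  qed
qed

lemma quadratic_monomial:
  fixes e :: "'n::finite \<Rightarrow> nat"
  assumes "sum e UNIV = 2"
  shows "\<exists>i j. \<forall>x :: 'n \<Rightarrow> 'b::comm_monoid_mult. (\<Prod>l\<in>UNIV. x l ^ e l) = x i * x j"
proof -
  obtain i e' where e': "sum e' UNIV = Suc 0"
    "\<And>x :: 'n \<Rightarrow> 'b. (\<Prod>l\<in>UNIV. x l ^ e l) = x i * (\<Prod>l\<in>UNIV. x l ^ e' l)"
    using monomial_split_variable[of e "Suc 0"] assms by (metis numeral_2_eq_2)
  obtain j e'' where e'': "sum e'' UNIV = 0"
    "\<And>x :: 'n \<Rightarrow> 'b. (\<Prod>l\<in>UNIV. x l ^ e' l) = x j * (\<Prod>l\<in>UNIV. x l ^ e'' l)"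
    using monomial_split_variable[OF e'(1)] by metis
  have "(\<Prod>l\<in>UNIV. x l ^ e l) = x i * x j" for x :: "'n \<Rightarrow> 'b"
    using e' e'' by simp
  then show ?thesis by blast
qed

text \<open>
  An exponent vector of total degree two picks out two coordinates, possibly equal. In this
  shape every identity for the polar form can be checked term by term, as an identity for
  products of two coordinates.
\<close>

lemma quadratic_form_eval:
  fixes q :: "('n::finite, 'a::idom) mpolynomial"
  assumes "quadratic_form q"
  obtains i j where "\<And>x. eval_fract q x =
    (\<Sum>m\<in>Poly_Mapping.keys q. to_fract (Poly_Mapping.lookup q m) * (x $ i m * x $ j m))"
proof -
  have "\<exists>i j. \<forall>x :: 'n \<Rightarrow> 'a fract. (\<Prod>l\<in>UNIV. x l ^ Poly_Mapping.lookup m l) = x i * x j"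
    if "m \<in> Poly_Mapping.keys q" for m
    using assms that
    by (intro quadratic_monomial) (auto simp: quadratic_form_def form_of_degree_def)
  then obtain i j where ij: "(\<Prod>l\<in>UNIV. x l ^ Poly_Mapping.lookup m l) = x (i m) * x (j m)"
    if "m \<in> Poly_Mapping.keys q" for m and x :: "'n \<Rightarrow> 'a fract"
    by metis
  show ?thesis
    by (rule that[of i j]) (simp add: eval_fract_def ij cong: sum.cong)
qed

lemma eval_fract_integral:
  assumes "quadratic_form q" "x \<in> integral_vectors"
  shows "eval_fract q x \<in> range to_fract"
proof -
  obtain i j where "\<And>x. eval_fract q x =
    (\<Sum>m\<in>Poly_Mapping.keys q. to_fract (Poly_Mapping.lookup q m) * (x $ i m * x $ j m))"
    using quadratic_form_eval[OF assms(1)] by blast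
  with assms(2) show ?thesis
    by (auto simp: integral_vectors_def intro!: range_to_fract_intros)
qed

section \<open>The polar form\<close>

definition polar :: "('n::finite, 'a::idom) mpolynomial \<Rightarrow> 'a fract ^ 'n \<Rightarrow> 'a fract ^ 'n \<Rightarrow> 'a fract"
  where "polar q x y = eval_fract q (x + y) - eval_fract q x - eval_fract q y"

lemma polar_commute: "polar q x y = polar q y x"
  by (simp add: polar_def add.commute)

lemma polar_integral:
  assumes "quadratic_form q" "x \<in> integral_vectors" "y \<in> integral_vectors"
  shows "polar q x y \<in> range to_fract"
  unfolding polar_def using assms
  by (intro range_to_fract_diff eval_fract_integral integral_vectors_add)

lemma eval_fract_scale:
  assumes "quadratic_form q"
  shows "eval_fract q (c *s x) = c\<^sup>2 * eval_fract q x"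
proof -
  obtain i j where eval: "\<And>x. eval_fract q x =
    (\<Sum>m\<in>Poly_Mapping.keys q. to_fract (Poly_Mapping.lookup q m) * (x $ i m * x $ j m))"
    using quadratic_form_eval[OF assms] by blast
  show ?thesis
    unfolding eval sum_distrib_left
    by (intro sum.cong) (simp_all add: power2_eq_square algebra_simps)
qed

lemma polar_scale_left:
  assumes "quadratic_form q"
  shows "polar q (c *s x) y = c * polar q x y"
proof -
  obtain i j where eval: "\<And>x. eval_fract q x =
    (\<Sum>m\<in>Poly_Mapping.keys q. to_fract (Poly_Mapping.lookup q m) * (x $ i m * x $ j m))"
    using quadratic_form_eval[OF assms] by blast
  show ?thesis
    unfolding polar_def eval sum_distrib_left sum_subtractf[symmetric]
    by (intro sum.cong) (simp_all add: algebra_simps)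
qed

lemma polar_scale_right:
  assumes "quadratic_form q"
  shows "polar q x (c *s y) = c * polar q x y"
  using polar_scale_left[OF assms] by (metis polar_commute)

lemma eval_fract_line:
  assumes "quadratic_form q"
  shows "eval_fract q (y + c *s v) = eval_fract q y + c * polar q y v + c\<^sup>2 * eval_fract q v"
proof -
  have "eval_fract q (y + c *s v) = eval_fract q y + polar q y (c *s v) + eval_fract q (c *s v)"
    by (simp add: polar_def)
  then show ?thesis
    by (simp only: polar_scale_right[OF assms] eval_fract_scale[OF assms])
qed

lemma eval_fract_diff:
  assumes "quadratic_form q"
  shows "eval_fract q (x - y) = eval_fract q x - polar q x y + eval_fract q y"
proof -
  have "x - y = x + (- 1) *s y"
    by (simp add: vec_eq_iff)
  then have "eval_fract q (x - y) = eval_fract q (x + (- 1) *s y)"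
    by (rule arg_cong)
  then show ?thesis
    by (simp only: eval_fract_line[OF assms]) simp
qed

section \<open>Descent along chords\<close>

text \<open>
  Restricted to the line through \<open>y\<close> and \<open>x\<close>, the equation \<open>q = q(x)\<close> is quadratic in the
  parameter with constant term \<open>q(y) - q(x)\<close> and leading coefficient \<open>q(x - y)\<close>. One root
  is \<open>1\<close>, and the product of the roots is the quotient of these two, so this quotient is the other root.
\<close>

lemma eval_fract_second_intersection:
  assumes "quadratic_form q" and nz: "eval_fract q (x - y) \<noteq> 0"
  shows "eval_fract q (y + ((eval_fract q y - eval_fract q x) / eval_fract q (x - y)) *s (x - y))
    = eval_fract q x"
proof -
  define v where "v = x - y"
  define c where "c = (eval_fract q y - eval_fract q x) / eval_fract q v"
  have cv: "c * eval_fract q v = eval_fract q y - eval_fract q x"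
    using nz by (simp add: c_def v_def)
  have B: "polar q y v = eval_fract q x - eval_fract q y - eval_fract q v"
    by (simp add: polar_def v_def)
  have "eval_fract q (y + c *s v) =
      eval_fract q y + c * polar q y v + c * (c * eval_fract q v)"
    by (simp add: eval_fract_line[OF assms(1)] power2_eq_square mult.assoc)
  also have "\<dots> = eval_fract q y + c * (eval_fract q x - eval_fract q y - eval_fract q v)
      + c * (eval_fract q y - eval_fract q x)"
    by (simp only: B cv)
  also have "\<dots> = eval_fract q y - c * eval_fract q v"
    by (simp add: algebra_simps)
  also have "\<dots> = eval_fract q x"
    unfolding cv by simp
  finally show ?thesis
    by (simp add: c_def v_def)
qed

text \<open>
  In the expansion of \<open>t q(x - y)\<close> the only term that could fail to be integral is
  \<open>t B(x,y)\<close>, and it equals \<open>B(t x, y)\<close>. Thus one factor \<open>t\<close> suffices although \<open>q\<close> has degree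
  two, and this is what makes the denominator shrink.
\<close>

lemma scaled_eval_fract_diff_integral:
  assumes q: "quadratic_form q"
    and d: "eval_fract q x \<in> range to_fract"
    and tx: "to_fract t *s x \<in> integral_vectors"
    and y: "y \<in> integral_vectors"
  shows "to_fract t * eval_fract q (x - y) \<in> range to_fract"
proof -
  have "to_fract t * eval_fract q (x - y) =
      to_fract t * eval_fract q x - polar q (to_fract t *s x) y + to_fract t * eval_fract q y"
    by (simp add: eval_fract_diff polar_scale_left q algebra_simps)
  also have "\<dots> \<in> range to_fract"
    by (intro range_to_fract_add range_to_fract_diff range_to_fract_mult[OF rangeI]
        d eval_fract_integral[OF q y] polar_integral[OF q tx y])
  finally show ?thesis .
qed

lemma chord_descent:
  fixes q :: "('n::finite, 'a::idom) mpolynomial"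
  assumes N: "discrete_mult_norm N" and q: "quadratic_form q" and E: "euclidean_form N q"
    and t: "t \<noteq> 0" and tx: "to_fract t *s x \<in> integral_vectors"
    and d: "eval_fract q x \<in> range to_fract"
    and x: "x \<notin> integral_vectors"
  obtains s z where "s \<noteq> 0" "N s < N t" "to_fract s *s z \<in> integral_vectors"
    "eval_fract q z = eval_fract q x"
proof -
  obtain y where y: "y \<in> integral_vectors"
    and pos: "0 < fract_norm N (eval_fract q (x - y))"
    and less: "fract_norm N (eval_fract q (x - y)) < 1"
    using E x by (auto simp: euclidean_form_def)
  obtain s where s: "to_fract t * eval_fract q (x - y) = to_fract s"
    using scaled_eval_fract_diff_integral[OF q d tx y] by blast
  have "eval_fract q (x - y) = to_fract s / to_fract t"
    using t by (simp add: s[symmetric])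
  then have "eval_fract q (x - y) = Fraction_Field.Fract s t"
    by (simp add: to_fract_def)
  then have norm: "fract_norm N (eval_fract q (x - y)) = of_nat (N s) / of_nat (N t)"
    by (simp add: fract_norm_Fract[OF N t])
  have N0: "N a = 0 \<longleftrightarrow> a = 0" for a
    using N by (simp add: discrete_mult_norm_def)
  have Nt: "N t > 0"
    using t N0[of t] by simp
  have "N s \<noteq> 0"
    using pos unfolding norm by (intro notI) simp
  then have s0: "s \<noteq> 0"
    by (simp only: N0 not_False_eq_True)
  have Ns: "N s < N t"
    using less Nt by (simp add: norm)
  have nz: "eval_fract q (x - y) \<noteq> 0"
    using s s0 by auto
  define a where "a = eval_fract q y - eval_fract q x"
  define z where "z = y + (a / eval_fract q (x - y)) *s (x - y)"
  have a: "a \<in> range to_fract"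
    unfolding a_def using eval_fract_integral[OF q y] d by (rule range_to_fract_diff)
  have "to_fract s * z $ i \<in> range to_fract" for i
  proof -
    have "to_fract s * z $ i
        = to_fract s * y $ i + to_fract s * (a / eval_fract q (x - y)) * (x $ i - y $ i)"
      by (simp add: z_def distrib_left mult.assoc)
    also have "to_fract s * (a / eval_fract q (x - y)) = a * to_fract t"
      using nz by (simp add: s[symmetric])
    also have "to_fract s * y $ i + a * to_fract t * (x $ i - y $ i)
        = to_fract s * y $ i + a * (to_fract t * x $ i - to_fract t * y $ i)"
      by (simp only: right_diff_distrib mult.assoc)
    also have "\<dots> \<in> range to_fract"
    proof -
      have yi: "y $ i \<in> range to_fract" and txi: "to_fract t * x $ i \<in> range to_fract"
        using y tx by (simp_all add: integral_vectors_def)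
      show ?thesis
        by (rule range_to_fract_add[OF range_to_fract_mult[OF rangeI yi]
            range_to_fract_mult[OF a range_to_fract_diff[OF txi range_to_fract_mult[OF rangeI yi]]]])
    qed
    finally show ?thesis .
  qed
  then have "to_fract s *s z \<in> integral_vectors"
    by (simp add: integral_vectors_def)
  moreover have "eval_fract q z = eval_fract q x"
    unfolding z_def a_def by (rule eval_fract_second_intersection[OF q nz])
  ultimately show ?thesis
    using that s0 Ns by blast
qed

theorem corollary2:
  fixes N :: "'a::idom \<Rightarrow> nat" and q :: "('n::finite, 'a) mpolynomial"
  assumes "discrete_mult_norm N"
    and "quadratic_form q"
    and "euclidean_form N q"
  shows "ADC_form q"
proof -
  have descent: "\<exists>y\<in>integral_vectors. eval_fract q y = eval_fract q x"
    if "t \<noteq> 0" "to_fract t *s x \<in> integral_vectors" "eval_fract q x \<in> range to_fract" for t x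
    using that
  proof (induction "N t" arbitrary: t x rule: less_induct)
    case less
    show ?case
    proof (cases "x \<in> integral_vectors")
      case False
      obtain s z where "s \<noteq> 0" "N s < N t" "to_fract s *s z \<in> integral_vectors"
        "eval_fract q z = eval_fract q x"
        using chord_descent[OF assms less.prems False] by blast
      with less.hyps[of s z] less.prems show ?thesis by simp
    qed auto
  qed
  have "\<exists>y\<in>integral_vectors. eval_fract q y = eval_fract q x"
    if "eval_fract q x \<in> range to_fract" for x
    by (rule common_denominator[of x]) (rule descent[OF _ _ that])
  moreover have "is_form q"
    using assms(3) by (simp add: euclidean_form_def)
  ultimately show ?thesis
    by (simp add: ADC_form_def)
qed

end
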